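(* Let $n\in\mathbb{N}_0$ and let $\kappa\in\mathbb{R}$ with $|\kappa|>0$. Define $c_0=1$ and \[ c_j=\prod_{k=0}^{j-1}\frac{2(n-k)}{\kappa},\qquad j>0 . \] Then \[ \begin{aligned} I_2(n,n+1,\kappa,t)=\;&c_n\left(it-\frac{1}{\kappa}\right)e^{i\kappa t}J_{0,\kappa}(t)+\sum_{j=1}^{n}\left(\frac{i\,t\,c_{n-j}}{2j+1}-\frac{c_{n-j}}{\kappa}+\frac{c_{n-j+1}}{2j-1}\right)t^je^{i\kappa t}J_{j,\kappa}(t)\\ &+\frac{c_0}{2n+1}\,t^{n+1}e^{i\kappa t}J_{n+1,\kappa}(t). \end{aligned} \]
   Context: $\mathbb{N}_0=\{0,1,2,\dots\}$ and $i$ is the imaginary unit. $J_m$ is the Bessel function of the first kind of integer order $m$, and $J_{m,\kappa}(t):=J_m(\kappa t)$ for real $t$. $I_2(n,m,\kappa,t):=\int t^nJ_{m,\kappa}(t)e^{i\kappa t}\,dt$ denotes the indefinite integral (an antiderivative in $t$ of $t^nJ_m(\kappa t)e^{i\kappa t}$); identities between indefinite integrals are understood up to an additive constant. Empty sums are $0$. *)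

theory Defs
  imports "HOL-Complex_Analysis.Complex_Analysis"
begin

text \<open>
  Bessel function of the first kind of integer order. The reciprocal Gamma function is entire and
  vanishes at the non-positive integers, so for negative \<open>m\<close> the terms with \<open>m + k < 0\<close> drop out
  and only non-negative powers of \<open>z / 2\<close> contribute.
\<close>

definition bessel_J :: "int \<Rightarrow> complex \<Rightarrow> complex" where
  "bessel_J m z =
     (\<Sum>k. (-1) ^ k / fact k * rGamma (of_int (m + int k + 1)) * (z / 2) powi (m + 2 * int k))"

definition bessel_J_scaled :: "int \<Rightarrow> real \<Rightarrow> real \<Rightarrow> complex" where
  "bessel_J_scaled m \<kappa> t = bessel_J m (of_real (\<kappa> * t))"

text \<open>
  The indefinite integral is the set of all antiderivatives on the real line, so that an identity
  up to an additive constant becomes an equality of sets of functions.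
\<close>

definition I2 :: "nat \<Rightarrow> int \<Rightarrow> real \<Rightarrow> (real \<Rightarrow> complex) set" where
  "I2 n m \<kappa> =
     {F. \<forall>t. (F has_vector_derivative
                of_real t ^ n * bessel_J_scaled m \<kappa> t * exp (\<i> * of_real (\<kappa> * t))) (at t)}"

definition c_coeff :: "nat \<Rightarrow> real \<Rightarrow> nat \<Rightarrow> real" where
  "c_coeff n \<kappa> j = (\<Prod>k<j. 2 * (real n - real k) / \<kappa>)"

end

theory Submission
  imports Defs
begin

text \<open>
  Write \<open>E z = exp (\<i> \<kappa> z)\<close> and \<open>u\<^sub>j z = z ^ j * J\<^sub>j (\<kappa> z) * E z\<close>. Up to the constant
  of integration, the right-hand side of the theorem is a rearrangement of
  \<open>\<Sum>j\<le>n. c (n - j) * (v\<^sub>j - u\<^sub>j / \<kappa>)\<close>, where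
  \<open>v\<^sub>j = (\<i> z u\<^sub>j + u\<^sub>j\<^sub>+\<^sub>1) / (2 j + 1)\<close>. Two facts make its derivative collapse.

  The function \<open>v\<^sub>j\<close> is an antiderivative of \<open>\<i> u\<^sub>j\<close>: in the derivative of \<open>\<i> z u\<^sub>j + u\<^sub>j\<^sub>+\<^sub>1\<close> all
  terms with a factor \<open>\<kappa>\<close> cancel (\<open>integral_bessel_u\<close>). So \<open>v\<^sub>j\<close> offsets the term that comes from
  differentiating the exponential in \<open>u\<^sub>j / \<kappa>\<close>, and what remains of the
  derivative of \<open>v\<^sub>j - u\<^sub>j / \<kappa>\<close> is
  \<open>- z ^ j * J\<^sub>j\<^sub>-\<^sub>1 (\<kappa> z) * E z\<close> for \<open>j > 0\<close> and \<open>J\<^sub>1 (\<kappa> z) * E z\<close> for \<open>j = 0\<close>.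

  The coefficients satisfy \<open>c (n - j) = c (n - j - 1) * 2 (j + 1) / \<kappa>\<close>, which matches the
  three-term recurrence of the Bessel functions, so the weighted sum of these remainders
  telescopes to \<open>z ^ n * J\<^sub>n\<^sub>+\<^sub>1 (\<kappa> z) * E z\<close> (\<open>sum_bessel_telescope\<close>).

  The recurrence and the derivative rules are derived without division by \<open>z\<close>, from the entire
  functions \<open>\<phi>\<^sub>m\<close> with \<open>J\<^sub>m z = (z / 2) ^ m * \<phi>\<^sub>m (z\<^sup>2 / 4)\<close>; hence nothing special happens at \<open>z = 0\<close>.
\<close>

section \<open>Bessel functions of nonnegative integer order\<close>

definition bessel_phi_coeff :: "nat \<Rightarrow> nat \<Rightarrow> complex" where
  "bessel_phi_coeff m k = (-1) ^ k / (fact k * fact (m + k))"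

text \<open>
  Up to the sign of the argument this is the Bessel--Clifford function.
\<close>

definition bessel_phi :: "nat \<Rightarrow> complex \<Rightarrow> complex" where
  "bessel_phi m w = (\<Sum>k. bessel_phi_coeff m k * w ^ k)"

lemma summable_bessel_phi: "summable (\<lambda>k. bessel_phi_coeff m k * w ^ k)"
proof (rule summable_comparison_test')
  show "summable (\<lambda>k. norm w ^ k / fact k)"
    using summable_exp[of "norm w"] by (simp add: field_simps)
  fix k :: nat
  have "(1 :: real) \<le> fact (m + k)"
    by (rule fact_ge_1)
  then have "norm w ^ k / (fact k * fact (m + k)) \<le> norm w ^ k / (fact k * 1)"
    by (intro divide_left_mono mult_left_mono) auto
  then show "norm (bessel_phi_coeff m k * w ^ k) \<le> norm w ^ k / fact k"
    by (simp add: bessel_phi_coeff_def norm_mult norm_divide norm_power)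
qed

text \<open>
  For nonnegative order the reciprocal Gamma function in the series is an inverse factorial.
\<close>

lemma bessel_J_of_nat: "bessel_J (int m) z = (z / 2) ^ m * bessel_phi m (z\<^sup>2 / 4)"
proof -
  have "(-1) ^ k / fact k * rGamma (of_int (int m + int k + 1)) * (z / 2) powi (int m + 2 * int k)
      = (z / 2) ^ m * (bessel_phi_coeff m k * (z\<^sup>2 / 4) ^ k)" for k
  proof -
    have "of_int (int m + int k + 1) = (1 + of_nat (m + k) :: complex)"
      by simp
    then have G: "rGamma (of_int (int m + int k + 1) :: complex) = inverse (fact (m + k))"
      by (simp only: rGamma_inverse_Gamma Gamma_fact)
    have "(z / 2) powi (int m + 2 * int k) = (z / 2) powi int (m + 2 * k)"
      by simp
    also have "\<dots> = (z / 2) ^ (m + 2 * k)"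
      by (rule power_int_of_nat)
    also have "\<dots> = (z / 2) ^ m * (z\<^sup>2 / 4) ^ k"
      by (simp add: power_add power_mult power_divide)
    finally have P: "(z / 2) powi (int m + 2 * int k) = (z / 2) ^ m * (z\<^sup>2 / 4) ^ k" .
    show ?thesis
      unfolding G P bessel_phi_coeff_def
      by (simp only: divide_inverse inverse_mult_distrib mult_ac)
  qed
  then show ?thesis
    unfolding bessel_J_def bessel_phi_def
    by (simp add: suminf_mult[OF summable_bessel_phi])
qed

lemma diffs_bessel_phi_coeff: "diffs (bessel_phi_coeff m) k = - bessel_phi_coeff (Suc m) k"
  unfolding diffs_def bessel_phi_coeff_def
  by (simp add: fact_Suc[of k] divide_simps del: of_nat_Suc)

lemma bessel_phi_has_field_derivative:
  "(bessel_phi m has_field_derivative - bessel_phi (Suc m) w) (at w)"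
proof -
  have "((\<lambda>w. \<Sum>k. bessel_phi_coeff m k * w ^ k) has_field_derivative
           (\<Sum>k. diffs (bessel_phi_coeff m) k * w ^ k)) (at w)"
    by (rule termdiffs_strong_converges_everywhere) (rule summable_bessel_phi)
  moreover have "(\<Sum>k. diffs (bessel_phi_coeff m) k * w ^ k) = - bessel_phi (Suc m) w"
    by (simp add: diffs_bessel_phi_coeff bessel_phi_def suminf_minus[OF summable_bessel_phi])
  ultimately show ?thesis
    by (simp add: bessel_phi_def[abs_def])
qed

text \<open>
  On coefficients this reads \<open>(m + 1 + k) / (m + 1 + k)! = 1 / (m + k)!\<close>: the part \<open>m + 1\<close> gives
  the first term, and the part \<open>k\<close> is \<open>w\<close> times a derivative, which shifts the index once more.
\<close>

lemma bessel_phi_recurrence: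
  "bessel_phi m w = of_nat (Suc m) * bessel_phi (Suc m) w - w * bessel_phi (Suc (Suc m)) w"
proof -
  let ?s = "\<lambda>m k. bessel_phi_coeff m k * w ^ k"
  have S: "?s m sums bessel_phi m w" for m
    unfolding bessel_phi_def by (rule summable_sums[OF summable_bessel_phi])
  have split: "?s m k = of_nat (Suc m) * ?s (Suc m) k + of_nat k * ?s (Suc m) k" for k
  proof -
    have "bessel_phi_coeff m k = of_nat (Suc m + k) * bessel_phi_coeff (Suc m) k"
      by (simp add: bessel_phi_coeff_def fact_Suc[of "m + k"] divide_simps del: of_nat_Suc of_nat_add)
    then show ?thesis
      by (simp add: algebra_simps)
  qed
  have "(\<lambda>k. of_nat k * ?s (Suc m) k) sums (- (w * bessel_phi (Suc (Suc m)) w))"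
  proof -
    have "of_nat (Suc k) * ?s (Suc m) (Suc k) = - (w * ?s (Suc (Suc m)) k)" for k
    proof -
      have "of_nat (Suc k) * bessel_phi_coeff (Suc m) (Suc k) = - bessel_phi_coeff (Suc (Suc m)) k"
        using diffs_bessel_phi_coeff[of "Suc m" k] by (simp only: diffs_def)
      then have "of_nat (Suc k) * bessel_phi_coeff (Suc m) (Suc k) * w ^ Suc k
          = - bessel_phi_coeff (Suc (Suc m)) k * w ^ Suc k"
        by simp
      then show ?thesis
        by (simp add: mult_ac del: of_nat_Suc)
    qed
    moreover have "(\<lambda>k. - (w * ?s (Suc (Suc m)) k)) sums (- (w * bessel_phi (Suc (Suc m)) w))"
      by (intro sums_minus sums_mult S)
    ultimately have "(\<lambda>k. of_nat (Suc k) * ?s (Suc m) (Suc k))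
        sums (- (w * bessel_phi (Suc (Suc m)) w))"
      by simp
    then show ?thesis
      by (subst (asm) sums_Suc_iff) simp
  qed
  then have "?s m sums
      (of_nat (Suc m) * bessel_phi (Suc m) w + - (w * bessel_phi (Suc (Suc m)) w))"
    unfolding split by (intro sums_add sums_mult S)
  with S[of m] show ?thesis
    by (simp add: sums_unique2)
qed

lemma bessel_J_recurrence:
  "z * (bessel_J (int m) z + bessel_J (int m + 2) z) = 2 * of_nat (Suc m) * bessel_J (int m + 1) z"
proof -
  have shift: "int m + 1 = int (Suc m)" "int m + 2 = int (Suc (Suc m))"
    by simp_all
  show ?thesis
    unfolding shift bessel_J_of_nat bessel_phi_recurrence[of m "z\<^sup>2 / 4"]
    by (simp add: power2_eq_square algebra_simps)
qed

lemma bessel_J_0_has_field_derivative: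
  "(bessel_J 0 has_field_derivative - bessel_J 1 z) (at z)"
proof -
  have "((\<lambda>z. bessel_phi 0 (z\<^sup>2 / 4)) has_field_derivative
          - bessel_phi (Suc 0) (z\<^sup>2 / 4) * (z / 2)) (at z)"
    by (rule DERIV_chain2[OF bessel_phi_has_field_derivative])
      (auto intro!: derivative_eq_intros)
  moreover have "bessel_J 0 = (\<lambda>z. bessel_phi 0 (z\<^sup>2 / 4))"
    using bessel_J_of_nat[of 0] by (auto simp: fun_eq_iff)
  moreover have "- bessel_phi (Suc 0) (z\<^sup>2 / 4) * (z / 2) = - bessel_J 1 z"
    using bessel_J_of_nat[of 1] by simp
  ultimately show ?thesis
    by (simp only:)
qed

text \<open>
  Since \<open>z ^ (m + 1) * J\<^sub>m\<^sub>+\<^sub>1 z = (z\<^sup>2 / 2) ^ (m + 1) * \<phi>\<^sub>m\<^sub>+\<^sub>1 (z\<^sup>2 / 4)\<close>, the product rule yields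
  \<open>z * (z\<^sup>2 / 2) ^ m\<close> times the right-hand side of the recurrence for \<open>\<phi>\<^sub>m\<close> at \<open>z\<^sup>2 / 4\<close>.
\<close>

lemma power_mult_bessel_J_has_field_derivative:
  "((\<lambda>z. z ^ Suc m * bessel_J (int m + 1) z) has_field_derivative
      z ^ Suc m * bessel_J (int m) z) (at z)"
proof -
  let ?w = "z\<^sup>2 / 4"
  have J: "z ^ Suc m * bessel_J (int m + 1) z = (z\<^sup>2 / 2) ^ Suc m * bessel_phi (Suc m) (z\<^sup>2 / 4)"
    for z
  proof -
    have "bessel_J (int m + 1) z = (z / 2) ^ Suc m * bessel_phi (Suc m) (z\<^sup>2 / 4)"
      using bessel_J_of_nat[of "Suc m"] by (simp add: add.commute)
    moreover have "z ^ Suc m * (z / 2) ^ Suc m = (z\<^sup>2 / 2) ^ Suc m"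
      by (simp only: power_mult_distrib[symmetric]) (simp add: power2_eq_square)
    ultimately show ?thesis
      by (simp only: mult.assoc[symmetric])
  qed
  have "((\<lambda>z. bessel_phi (Suc m) (z\<^sup>2 / 4)) has_field_derivative
          - bessel_phi (Suc (Suc m)) ?w * (z / 2)) (at z)"
    by (rule DERIV_chain2[OF bessel_phi_has_field_derivative])
      (auto intro!: derivative_eq_intros)
  moreover have "((\<lambda>z. (z\<^sup>2 / 2) ^ Suc m) has_field_derivative
      (1 + of_nat m) * (z * (z\<^sup>2 / 2) ^ m)) (at z)"
    by (rule DERIV_power_Suc) (auto intro!: derivative_eq_intros)
  ultimately have "((\<lambda>z. (z\<^sup>2 / 2) ^ Suc m * bessel_phi (Suc m) (z\<^sup>2 / 4)) has_field_derivative
      (1 + of_nat m) * (z * (z\<^sup>2 / 2) ^ m) * bessel_phi (Suc m) ?w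
        + - bessel_phi (Suc (Suc m)) ?w * (z / 2) * (z\<^sup>2 / 2) ^ Suc m) (at z)"
    by (rule DERIV_mult[rotated])
  moreover have "(1 + of_nat m) * (z * (z\<^sup>2 / 2) ^ m) * bessel_phi (Suc m) ?w
        + - bessel_phi (Suc (Suc m)) ?w * (z / 2) * (z\<^sup>2 / 2) ^ Suc m
      = z * (z\<^sup>2 / 2) ^ m * bessel_phi m ?w"
    unfolding bessel_phi_recurrence[of m ?w] by (simp add: algebra_simps power2_eq_square)
  moreover have "\<dots> = z ^ Suc m * bessel_J (int m) z"
  proof -
    have "(z\<^sup>2 / 2) ^ m = z ^ m * (z / 2) ^ m"
      by (simp only: power_mult_distrib[symmetric]) (simp add: power2_eq_square)
    then show ?thesis
      unfolding bessel_J_of_nat by (simp only: power_Suc mult_ac)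
  qed
  ultimately show ?thesis
    unfolding J by (simp only:)
qed

section \<open>Antiderivatives of Bessel functions times powers and exponentials\<close>

definition bessel_u :: "complex \<Rightarrow> nat \<Rightarrow> complex \<Rightarrow> complex" where
  "bessel_u \<kappa> j z = z ^ j * exp (\<i> * (\<kappa> * z)) * bessel_J (int j) (\<kappa> * z)"

lemma bessel_u_recurrence:
  "\<kappa> * (z\<^sup>2 * bessel_u \<kappa> j z + bessel_u \<kappa> (Suc (Suc j)) z)
    = 2 * of_nat (Suc j) * bessel_u \<kappa> (Suc j) z"
proof -
  have "\<kappa> * (z\<^sup>2 * bessel_u \<kappa> j z + bessel_u \<kappa> (Suc (Suc j)) z)
      = z ^ Suc j * exp (\<i> * (\<kappa> * z))
          * (\<kappa> * z * (bessel_J (int j) (\<kappa> * z) + bessel_J (int j + 2) (\<kappa> * z)))"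
    by (simp add: bessel_u_def algebra_simps power2_eq_square)
  then show ?thesis
    unfolding bessel_J_recurrence
    by (simp add: bessel_u_def mult_ac add.commute)
qed

lemma bessel_u_0_has_field_derivative:
  "(bessel_u \<kappa> 0 has_field_derivative
      \<i> * \<kappa> * bessel_u \<kappa> 0 z - \<kappa> * exp (\<i> * (\<kappa> * z)) * bessel_J 1 (\<kappa> * z)) (at z)"
proof -
  have "((\<lambda>z. bessel_J 0 (\<kappa> * z)) has_field_derivative - bessel_J 1 (\<kappa> * z) * \<kappa>) (at z)"
    by (rule DERIV_chain2[OF bessel_J_0_has_field_derivative]) (auto intro!: derivative_eq_intros)
  moreover have "((\<lambda>z. exp (\<i> * (\<kappa> * z))) has_field_derivative \<i> * \<kappa> * exp (\<i> * (\<kappa> * z))) (at z)"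
    by (auto intro!: derivative_eq_intros)
  ultimately have "((\<lambda>z. exp (\<i> * (\<kappa> * z)) * bessel_J 0 (\<kappa> * z)) has_field_derivative
      \<i> * \<kappa> * exp (\<i> * (\<kappa> * z)) * bessel_J 0 (\<kappa> * z)
        + - bessel_J 1 (\<kappa> * z) * \<kappa> * exp (\<i> * (\<kappa> * z))) (at z)"
    by (rule DERIV_mult[rotated])
  then show ?thesis
    by (simp add: bessel_u_def[abs_def] algebra_simps)
qed

lemma bessel_u_Suc_has_field_derivative:
  assumes "\<kappa> \<noteq> 0"
  shows "(bessel_u \<kappa> (Suc j) has_field_derivative
            \<i> * \<kappa> * bessel_u \<kappa> (Suc j) z + \<kappa> * z * bessel_u \<kappa> j z) (at z)"
proof -
  have "((\<lambda>z. (\<kappa> * z) ^ Suc j * bessel_J (int j + 1) (\<kappa> * z)) has_field_derivative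
          (\<kappa> * z) ^ Suc j * bessel_J (int j) (\<kappa> * z) * \<kappa>) (at z)"
    by (rule DERIV_chain2[OF power_mult_bessel_J_has_field_derivative])
      (auto intro!: derivative_eq_intros)
  \<comment> \<open>The factor \<open>1 / \<kappa> ^ (j + 1)\<close> turns the power of \<open>\<kappa> z\<close> into the power of \<open>z\<close> in \<open>u\<close>.\<close>
  moreover have "((\<lambda>z. exp (\<i> * (\<kappa> * z)) / \<kappa> ^ Suc j) has_field_derivative
      \<i> * \<kappa> * exp (\<i> * (\<kappa> * z)) / \<kappa> ^ Suc j) (at z)"
    by (rule DERIV_cdivide) (auto intro!: derivative_eq_intros)
  ultimately have "((\<lambda>z. exp (\<i> * (\<kappa> * z)) / \<kappa> ^ Suc j * ((\<kappa> * z) ^ Suc j * bessel_J (int j + 1) (\<kappa> * z)))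
      has_field_derivative
        \<i> * \<kappa> * exp (\<i> * (\<kappa> * z)) / \<kappa> ^ Suc j * ((\<kappa> * z) ^ Suc j * bessel_J (int j + 1) (\<kappa> * z))
        + (\<kappa> * z) ^ Suc j * bessel_J (int j) (\<kappa> * z) * \<kappa> * (exp (\<i> * (\<kappa> * z)) / \<kappa> ^ Suc j)) (at z)"
    by (rule DERIV_mult[rotated])
  moreover have "exp (\<i> * (\<kappa> * z)) / \<kappa> ^ Suc j * ((\<kappa> * z) ^ Suc j * bessel_J (int j + 1) (\<kappa> * z))
      = bessel_u \<kappa> (Suc j) z" for z
    using assms by (simp add: bessel_u_def power_mult_distrib add.commute[of 1])
  moreover have "\<i> * \<kappa> * exp (\<i> * (\<kappa> * z)) / \<kappa> ^ Suc j * ((\<kappa> * z) ^ Suc j * bessel_J (int j + 1) (\<kappa> * z))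
        + (\<kappa> * z) ^ Suc j * bessel_J (int j) (\<kappa> * z) * \<kappa> * (exp (\<i> * (\<kappa> * z)) / \<kappa> ^ Suc j)
      = \<i> * \<kappa> * bessel_u \<kappa> (Suc j) z + \<kappa> * z * bessel_u \<kappa> j z"
    using assms by (simp add: bessel_u_def power_mult_distrib add.commute[of 1])
  ultimately show ?thesis
    by (simp only:)
qed

text \<open>
  By the recurrence (by \<open>J\<^sub>0' = - J\<^sub>1\<close> if \<open>j = 0\<close>), \<open>(z u\<^sub>j)' = (2 j + 1) u\<^sub>j - \<kappa> u\<^sub>j\<^sub>+\<^sub>1 + \<i> \<kappa> z u\<^sub>j\<close>; adding
  \<open>- \<i> u\<^sub>j\<^sub>+\<^sub>1\<close> to \<open>z u\<^sub>j\<close>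
  replaces the last two terms by \<open>0\<close>; a factor \<open>\<i>\<close> gives the form below.
\<close>

lemma integral_bessel_u:
  assumes "\<kappa> \<noteq> 0"
  shows "((\<lambda>z. (\<i> * z * bessel_u \<kappa> j z + bessel_u \<kappa> (Suc j) z) / of_nat (2 * j + 1))
            has_field_derivative \<i> * bessel_u \<kappa> j z) (at z)"
proof -
  have "((\<lambda>z. z * bessel_u \<kappa> j z) has_field_derivative
      of_nat (2 * j + 1) * bessel_u \<kappa> j z - \<kappa> * bessel_u \<kappa> (Suc j) z
        + \<i> * \<kappa> * z * bessel_u \<kappa> j z) (at z)"
  proof (cases j)
    case 0
    have "z * exp (\<i> * (\<kappa> * z)) * bessel_J 1 (\<kappa> * z) = bessel_u \<kappa> (Suc 0) z"
      by (simp add: bessel_u_def)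
    then show ?thesis
      using DERIV_mult[OF DERIV_ident bessel_u_0_has_field_derivative[of \<kappa> z]] 0
      by (simp add: algebra_simps)
  next
    case (Suc i)
    have "1 * bessel_u \<kappa> j z + (\<i> * \<kappa> * bessel_u \<kappa> j z + \<kappa> * z * bessel_u \<kappa> i z) * z
        = bessel_u \<kappa> j z + \<i> * \<kappa> * z * bessel_u \<kappa> j z + \<kappa> * (z\<^sup>2 * bessel_u \<kappa> i z)"
      by (simp add: algebra_simps power2_eq_square)
    also have "\<kappa> * (z\<^sup>2 * bessel_u \<kappa> i z) =
        2 * of_nat j * bessel_u \<kappa> j z - \<kappa> * bessel_u \<kappa> (Suc j) z"
      unfolding Suc bessel_u_recurrence[of \<kappa> z i, symmetric] by (simp add: algebra_simps)
    also have "bessel_u \<kappa> j z + \<i> * \<kappa> * z * bessel_u \<kappa> j z + \<dots> =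
        of_nat (2 * j + 1) * bessel_u \<kappa> j z - \<kappa> * bessel_u \<kappa> (Suc j) z
          + \<i> * \<kappa> * z * bessel_u \<kappa> j z"
      by (simp add: algebra_simps)
    finally show ?thesis
      using DERIV_mult[OF DERIV_ident bessel_u_Suc_has_field_derivative[OF assms, of i z]] Suc
      by (simp only:)
  qed
  note deriv_z_u = this
  have "((\<lambda>z. (\<i> * (z * bessel_u \<kappa> j z) + bessel_u \<kappa> (Suc j) z) / of_nat (2 * j + 1))
      has_field_derivative
        (\<i> * (of_nat (2 * j + 1) * bessel_u \<kappa> j z - \<kappa> * bessel_u \<kappa> (Suc j) z
               + \<i> * \<kappa> * z * bessel_u \<kappa> j z)
         + (\<i> * \<kappa> * bessel_u \<kappa> (Suc j) z + \<kappa> * z * bessel_u \<kappa> j z)) / of_nat (2 * j + 1)) (at z)"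
    by (intro DERIV_cdivide DERIV_add DERIV_cmult deriv_z_u
        bessel_u_Suc_has_field_derivative assms)
  moreover have "\<i> * (of_nat (2 * j + 1) * bessel_u \<kappa> j z - \<kappa> * bessel_u \<kappa> (Suc j) z
               + \<i> * \<kappa> * z * bessel_u \<kappa> j z)
         + (\<i> * \<kappa> * bessel_u \<kappa> (Suc j) z + \<kappa> * z * bessel_u \<kappa> j z)
      = of_nat (2 * j + 1) * (\<i> * bessel_u \<kappa> j z)"
    by (simp add: algebra_simps)
  moreover have "(of_nat (2 * j + 1) :: complex) \<noteq> 0"
    by (simp only: of_nat_eq_0_iff)
  ultimately show ?thesis
    by (simp add: mult.assoc del: of_nat_add of_nat_mult)
qed

definition bessel_v_minus_u :: "complex \<Rightarrow> nat \<Rightarrow> complex \<Rightarrow> complex" where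
  "bessel_v_minus_u \<kappa> j z =
     (\<i> * z * bessel_u \<kappa> j z + bessel_u \<kappa> (Suc j) z) / of_nat (2 * j + 1) - bessel_u \<kappa> j z / \<kappa>"

text \<open>
  The two cases are the single expression \<open>- z ^ j * J\<^sub>j\<^sub>-\<^sub>1 (\<kappa> z) * E z\<close> if one uses
  \<open>J\<^sub>-\<^sub>1 = - J\<^sub>1\<close>; separating them avoids negative orders.
\<close>

lemma bessel_v_minus_u_has_field_derivative:
  assumes "\<kappa> \<noteq> 0"
  shows "(bessel_v_minus_u \<kappa> j has_field_derivative
      (case j of 0 \<Rightarrow> exp (\<i> * (\<kappa> * z)) * bessel_J 1 (\<kappa> * z)
               | Suc i \<Rightarrow> - z * bessel_u \<kappa> i z)) (at z)"
proof (cases j)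
  case 0
  show ?thesis
    unfolding bessel_v_minus_u_def[abs_def] 0
    using DERIV_diff[OF integral_bessel_u[OF assms, of 0]
        DERIV_cdivide[OF bessel_u_0_has_field_derivative[of \<kappa> z], where c = \<kappa>]] assms
    by (simp add: diff_divide_distrib)
next
  case (Suc i)
  show ?thesis
    unfolding bessel_v_minus_u_def[abs_def] Suc
    using DERIV_diff[OF integral_bessel_u[OF assms, of "Suc i"]
        DERIV_cdivide[OF bessel_u_Suc_has_field_derivative[OF assms, of i z], where c = \<kappa>]] assms
    by (simp add: add_divide_distrib)
qed

text \<open>
  With this ratio of \<open>a j\<close> and \<open>a (j + 1)\<close>, the value of the partial sum up to \<open>j\<close> contains
  \<open>2 (j + 1) / \<kappa> * J\<^sub>j\<^sub>+\<^sub>1 = z * (J\<^sub>j + J\<^sub>j\<^sub>+\<^sub>2)\<close>, taken at \<open>\<kappa> z\<close>; the summand of index \<open>j + 1\<close>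
  removes \<open>J\<^sub>j\<close> and leaves \<open>J\<^sub>j\<^sub>+\<^sub>2\<close>.
\<close>

lemma sum_bessel_telescope:
  assumes "\<kappa> \<noteq> 0"
    and "\<And>j. j < N \<Longrightarrow> a j = a (Suc j) * (2 * of_nat (Suc j) / \<kappa>)"
  shows "(\<Sum>j\<le>N. a j * (case j of 0 \<Rightarrow> exp (\<i> * (\<kappa> * z)) * bessel_J 1 (\<kappa> * z)
                                    | Suc i \<Rightarrow> - z * bessel_u \<kappa> i z))
         = a N * (z ^ N * exp (\<i> * (\<kappa> * z)) * bessel_J (int N + 1) (\<kappa> * z))"
  using assms(2)
proof (induction N)
  case 0
  then show ?case
    by simp
next
  case (Suc N)
  let ?E = "exp (\<i> * (\<kappa> * z))"
  have aN: "a N = a (Suc N) * (2 * of_nat (Suc N) / \<kappa>)"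
    using Suc.prems by blast
  have rec: "2 * of_nat (Suc N) / \<kappa> * bessel_J (int N + 1) (\<kappa> * z)
      = z * (bessel_J (int N) (\<kappa> * z) + bessel_J (int N + 2) (\<kappa> * z))"
    using bessel_J_recurrence[of "\<kappa> * z" N] assms(1) by (simp add: field_simps del: of_nat_Suc)
  have "a N * (z ^ N * ?E * bessel_J (int N + 1) (\<kappa> * z))
      = a (Suc N) * z ^ N * ?E * (2 * of_nat (Suc N) / \<kappa> * bessel_J (int N + 1) (\<kappa> * z))"
    unfolding aN by (simp add: mult_ac)
  also have "\<dots> = a (Suc N) * z ^ N * ?E
      * (z * (bessel_J (int N) (\<kappa> * z) + bessel_J (int N + 2) (\<kappa> * z)))"
    unfolding rec ..
  finally show ?case
    using Suc by (simp add: bessel_u_def algebra_simps)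
qed

text \<open>
  In the sum on the left, \<open>u\<^sub>j\<close> occurs in the summand of index \<open>j\<close> and, for \<open>j > 0\<close>, with
  coefficient \<open>a (j - 1) / (2 j - 1)\<close> in the summand of index \<open>j - 1\<close>.
\<close>

lemma sum_bessel_v_minus_u:
  "(\<Sum>j\<le>N. a j * bessel_v_minus_u \<kappa> j z)
   = a 0 * (\<i> * z - 1 / \<kappa>) * bessel_u \<kappa> 0 z
     + (\<Sum>j=1..N. (\<i> * z * a j / of_nat (2 * j + 1) - a j / \<kappa> + a (j - 1) / of_nat (2 * j - 1))
                    * bessel_u \<kappa> j z)
     + a N / of_nat (2 * N + 1) * bessel_u \<kappa> (Suc N) z"
proof (induction N)
  case 0
  show ?case
    by (simp add: bessel_v_minus_u_def algebra_simps)
next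
  case (Suc N)
  have "a (Suc N) * bessel_v_minus_u \<kappa> (Suc N) z + a N / of_nat (2 * N + 1) * bessel_u \<kappa> (Suc N) z
    = (\<i> * z * a (Suc N) / of_nat (2 * Suc N + 1) - a (Suc N) / \<kappa> + a N / of_nat (2 * N + 1))
        * bessel_u \<kappa> (Suc N) z + a (Suc N) / of_nat (2 * Suc N + 1) * bessel_u \<kappa> (Suc (Suc N)) z"
    unfolding bessel_v_minus_u_def
    by (simp add: algebra_simps add_divide_distrib diff_divide_distrib
        del: of_nat_Suc of_nat_add of_nat_mult mult_Suc_right)
  note step = this
  have odd: "2 * Suc N - 1 = 2 * N + 1"
    by simp
  have split: "(\<Sum>j=1..Suc N. f j) = (\<Sum>j=1..N. f j) + f (Suc N)" for f :: "nat \<Rightarrow> complex"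
    by simp
  have "x + y + q + p = x + (y + r) + s" if "p + q = r + s" for p q r s x y :: complex
    using that by algebra
  from this[OF step] show ?case
    unfolding sum.atMost_Suc Suc.IH split odd diff_Suc_1 .
qed

section \<open>The indefinite integral\<close>

lemma c_coeff_diff:
  assumes "j < n"
  shows "c_coeff n \<kappa> (n - j) = c_coeff n \<kappa> (n - Suc j) * (2 * real (Suc j) / \<kappa>)"
proof -
  have "n - j = Suc (n - Suc j)" "real n - real (n - Suc j) = real (Suc j)"
    using assms by (auto simp: of_nat_diff)
  then show ?thesis
    by (simp add: c_coeff_def)
qed

lemma I2_eq_if_mem:
  assumes "G \<in> I2 n m \<kappa>"
  shows "I2 n m \<kappa> = {(\<lambda>t. G t + C) | C. True}"
proof (intro equalityI subsetI)
  fix F assume "F \<in> I2 n m \<kappa>"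
  then have "((\<lambda>t. F t - G t) has_vector_derivative 0) (at t)" for t
    using assms has_vector_derivative_diff[of F _ "at t" G] unfolding I2_def by fastforce
  then obtain C where "F t - G t = C" for t
    using has_vector_derivative_zero_constant[of UNIV "\<lambda>t. F t - G t"] by auto
  then have "F = (\<lambda>t. G t + C)"
    by (auto simp: fun_eq_iff algebra_simps)
  then show "F \<in> {(\<lambda>t. G t + C) | C. True}"
    by blast
next
  fix F assume "F \<in> {(\<lambda>t. G t + C) | C. True}"
  then obtain C where "F = (\<lambda>t. G t + C)"
    by blast
  then show "F \<in> I2 n m \<kappa>"
    using assms by (auto simp: I2_def intro!: derivative_eq_intros)
qed

theorem proposition3p3:
  fixes n :: nat and \<kappa> :: real
  assumes "\<bar>\<kappa>\<bar> > 0"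
  defines "c \<equiv> \<lambda>j. complex_of_real (c_coeff n \<kappa> j)"
  shows "I2 n (int n + 1) \<kappa> =
    {(\<lambda>t::real.
        c n * (\<i> * of_real t - 1 / of_real \<kappa>) * exp (\<i> * of_real (\<kappa> * t)) * bessel_J_scaled 0 \<kappa> t
      + (\<Sum>j=1..n. (\<i> * of_real t * c (n - j) / of_nat (2 * j + 1) - c (n - j) / of_real \<kappa>
                      + c (n - j + 1) / of_nat (2 * j - 1))
                    * of_real t ^ j * exp (\<i> * of_real (\<kappa> * t)) * bessel_J_scaled (int j) \<kappa> t)
      + c 0 / of_nat (2 * n + 1) * of_real t ^ (n + 1) * exp (\<i> * of_real (\<kappa> * t))
          * bessel_J_scaled (int n + 1) \<kappa> t
      + C) | C :: complex. True}"
proof (rule I2_eq_if_mem)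
  define k where "k = complex_of_real \<kappa>"
  have k: "k \<noteq> 0"
    using assms(1) by (simp add: k_def)
  define a where "a = (\<lambda>j. c (n - j))"
  have a: "a j = a (Suc j) * (2 * of_nat (Suc j) / k)" if "j < n" for j
    using c_coeff_diff[OF that, of \<kappa>]
    by (simp add: a_def c_def k_def del: of_nat_Suc)
  have "((\<lambda>t. \<Sum>j\<le>n. a j * bessel_v_minus_u k j (of_real t)) has_vector_derivative
      of_real t ^ n * bessel_J_scaled (int n + 1) \<kappa> t * exp (\<i> * of_real (\<kappa> * t))) (at t)" for t
  proof -
    have "((\<lambda>z. \<Sum>j\<le>n. a j * bessel_v_minus_u k j z) has_field_derivative
        a n * (of_real t ^ n * exp (\<i> * (k * of_real t)) * bessel_J (int n + 1) (k * of_real t)))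
        (at (of_real t))"
      by (subst sum_bessel_telescope[OF k a, symmetric], assumption)
        (intro DERIV_sum DERIV_cmult bessel_v_minus_u_has_field_derivative k)
    note has_vector_derivative_real_field[OF this, of UNIV]
    moreover have "a n = 1"
      by (simp add: a_def c_def c_coeff_def)
    ultimately show ?thesis
      by (simp add: bessel_J_scaled_def k_def mult_ac)
  qed
  moreover have "(\<Sum>j\<le>n. a j * bessel_v_minus_u k j (of_real t)) =
        c n * (\<i> * of_real t - 1 / of_real \<kappa>) * exp (\<i> * of_real (\<kappa> * t)) * bessel_J_scaled 0 \<kappa> t
      + (\<Sum>j=1..n. (\<i> * of_real t * c (n - j) / of_nat (2 * j + 1) - c (n - j) / of_real \<kappa>
                      + c (n - j + 1) / of_nat (2 * j - 1))
                    * of_real t ^ j * exp (\<i> * of_real (\<kappa> * t)) * bessel_J_scaled (int j) \<kappa> t)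
      + c 0 / of_nat (2 * n + 1) * of_real t ^ (n + 1) * exp (\<i> * of_real (\<kappa> * t))
          * bessel_J_scaled (int n + 1) \<kappa> t" for t
  proof -
    have "(\<Sum>j=1..n. (\<i> * of_real t * a j / of_nat (2 * j + 1) - a j / k + a (j - 1) / of_nat (2 * j - 1))
                    * bessel_u k j (of_real t))
      = (\<Sum>j=1..n. (\<i> * of_real t * c (n - j) / of_nat (2 * j + 1) - c (n - j) / of_real \<kappa>
                      + c (n - j + 1) / of_nat (2 * j - 1))
                    * of_real t ^ j * exp (\<i> * of_real (\<kappa> * t)) * bessel_J_scaled (int j) \<kappa> t)"
    proof (rule sum.cong[OF refl], goal_cases)
      case (1 j)
      then have "n - (j - 1) = n - j + 1"
        by auto
      then show ?case
        unfolding a_def bessel_u_def bessel_J_scaled_def k_def by (simp only: of_real_mult mult.assoc)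
    qed
    moreover have "a 0 * (\<i> * of_real t - 1 / k) * bessel_u k 0 (of_real t)
      = c n * (\<i> * of_real t - 1 / of_real \<kappa>) * exp (\<i> * of_real (\<kappa> * t)) * bessel_J_scaled 0 \<kappa> t"
      by (simp add: a_def bessel_u_def bessel_J_scaled_def k_def)
    moreover have "a n / of_nat (2 * n + 1) * bessel_u k (Suc n) (of_real t)
      = c 0 / of_nat (2 * n + 1) * of_real t ^ (n + 1) * exp (\<i> * of_real (\<kappa> * t))
          * bessel_J_scaled (int n + 1) \<kappa> t"
      by (simp add: a_def bessel_u_def bessel_J_scaled_def k_def add.commute[of 1 "int n"])
    ultimately show ?thesis
      unfolding sum_bessel_v_minus_u by (simp only:)
  qed
  ultimately show "(\<lambda>t::real.
        c n * (\<i> * of_real t - 1 / of_real \<kappa>) * exp (\<i> * of_real (\<kappa> * t)) * bessel_J_scaled 0 \<kappa> t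
      + (\<Sum>j=1..n. (\<i> * of_real t * c (n - j) / of_nat (2 * j + 1) - c (n - j) / of_real \<kappa>
                      + c (n - j + 1) / of_nat (2 * j - 1))
                    * of_real t ^ j * exp (\<i> * of_real (\<kappa> * t)) * bessel_J_scaled (int j) \<kappa> t)
      + c 0 / of_nat (2 * n + 1) * of_real t ^ (n + 1) * exp (\<i> * of_real (\<kappa> * t))
          * bessel_J_scaled (int n + 1) \<kappa> t) \<in> I2 n (int n + 1) \<kappa>"
    unfolding I2_def by simp
qed

end
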